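(* Let $\langle x_n\rangle_{n=1}^{\infty}$ be a sequence in $\mathbb{N}$ and let $A\subseteq\mathbb{N}$ be an $IP^{*}$ set in $(\mathbb{N},+)$. Then there exists a sum subsystem $\langle y_n\rangle_{n=1}^{\infty}$ of $\langle x_n\rangle_{n=1}^{\infty}$ such that $$FS\left(\langle y_n\rangle_{n=1}^{\infty}\right)\cup FP\left(\langle y_n\rangle_{n=1}^{\infty}\right)\subseteq A.$$
   Context: $\mathbb{N}=\{1,2,3,\ldots\}$ denotes the set of positive integers. For a sequence $\langle x_n\rangle_{n=1}^{\infty}$ in $\mathbb{N}$, $FS(\langle x_n\rangle_{n=1}^{\infty})=\{\sum_{t\in H}x_t : H \text{ a nonempty finite subset of } \mathbb{N}\}$ is the set of all finite sums, and $FP(\langle x_n\rangle_{n=1}^{\infty})=\{\prod_{t\in H}x_t : H \text{ a nonempty finite subset of } \mathbb{N}\}$ is the set of all finite products. A subset of $\mathbb{N}$ is an $IP$ set (in $(\mathbb{N},+)$) if it contains $FS(\langle x_n\rangle_{n=1}^{\infty})$ for some sequence $\langle x_n\rangle_{n=1}^{\infty}$ in $\mathbb{N}$. A subset of $\mathbb{N}$ is an $IP^{*}$ set (in $(\mathbb{N},+)$) if it has nonempty intersection with every $IP$ set. A sequence $\langle y_n\rangle_{n=1}^{\infty}$ is a sum subsystem of $\langle x_n\rangle_{n=1}^{\infty}$ if there exists a sequence $\langle H_n\rangle_{n=1}^{\infty}$ of nonempty finite subsets of $\mathbb{N}$ such that $\max H_n<\min H_{n+1}$ and $y_n=\sum_{t\in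 H_n}x_t$ for each $n\in\mathbb{N}$. *)

theory Defs
  imports Main
begin

(* The positive integers are rendered as the subset {1..} of type nat; in particular every
   sequence called "in N" takes only positive values. Sequences are indexed by nat starting at 0
   instead of 1; the indices enter only through their order, so this is a pure relabelling. *)

definition pos_seq :: "(nat \<Rightarrow> nat) \<Rightarrow> bool" where
  "pos_seq x \<longleftrightarrow> (\<forall>n. x n \<in> {1..})"

definition FS :: "(nat \<Rightarrow> nat) \<Rightarrow> nat set" where
  "FS x = {\<Sum>t\<in>H. x t | H. finite H \<and> H \<noteq> {}}"

definition FP :: "(nat \<Rightarrow> nat) \<Rightarrow> nat set" where
  "FP x = {\<Prod>t\<in>H. x t | H. finite H \<and> H \<noteq> {}}"

definition IP_set :: "nat set \<Rightarrow> bool" where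
  "IP_set B \<longleftrightarrow> B \<subseteq> {1..} \<and> (\<exists>x. pos_seq x \<and> FS x \<subseteq> B)"

definition IP_star_set :: "nat set \<Rightarrow> bool" where
  "IP_star_set A \<longleftrightarrow> A \<subseteq> {1..} \<and> (\<forall>B. IP_set B \<longrightarrow> A \<inter> B \<noteq> {})"

definition sum_subsystem :: "(nat \<Rightarrow> nat) \<Rightarrow> (nat \<Rightarrow> nat) \<Rightarrow> bool" where
  "sum_subsystem y x \<longleftrightarrow>
     (\<exists>H :: nat \<Rightarrow> nat set.
        (\<forall>n. finite (H n) \<and> H n \<noteq> {}) \<and>
        (\<forall>n. Max (H n) < Min (H (Suc n))) \<and>
        (\<forall>n. y n = (\<Sum>t\<in>H n. x t)))"

end

theory Submission
  imports Defs
begin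

text \<open>
  If \<open>A\<close> is an \<open>IP\<^sup>*\<close> set, then so is \<open>{m. p * m \<in> A}\<close> for every positive \<open>p\<close>, because multiplication
  by \<open>p\<close> maps finite sums to finite sums. By Hindman's theorem, in Baumgartner's combinatorial form,
  every sequence therefore has a sum subsystem all of whose finite sums lie in finitely many such
  sets at once. Passing to such a subsystem each time a new term \<open>y\<^sub>n\<close> has been chosen, with \<open>p\<close>
  ranging over the products of the terms chosen so far, and diagonalising gives the result.
\<close>

section \<open>Block families\<close>

text \<open>Stated elementwise rather than with \<open>Max\<close> and \<open>Min\<close>, so that
  it also covers the empty set, which every set precedes vacuously.\<close>

definition precedes :: "nat set \<Rightarrow> nat set \<Rightarrow> bool"  (infix "\<lless>" 50) where
  "H \<lless> K \<longleftrightarrow> (\<forall>h\<in>H. \<forall>k\<in>K. h < k)"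

text \<open>
  Block families replace the sets of finite unions of a sequence of blocks, so that passing to a
  subsystem becomes passing to a subset that is again a block family.
\<close>

definition block_family :: "nat set set \<Rightarrow> bool" where
  "block_family U \<longleftrightarrow>
     (\<forall>H\<in>U. finite H \<and> H \<noteq> {}) \<and>
     (\<forall>m. \<exists>H\<in>U. {..m} \<lless> H) \<and>
     (\<forall>H\<in>U. \<forall>K\<in>U. H \<lless> K \<longrightarrow> H \<union> K \<in> U)"

definition beyond :: "nat set \<Rightarrow> nat set set \<Rightarrow> nat set set" where
  "beyond d U = {H \<in> U. d \<lless> H}"

text \<open>Baumgartner's notion of largeness. It is inherited by subfamilies of \<open>U\<close>,
  which is what lets the arguments below shrink \<open>U\<close> repeatedly.\<close>

definition large :: "nat set set \<Rightarrow> nat set set \<Rightarrow> bool" where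
  "large C U \<longleftrightarrow> (\<forall>V\<subseteq>U. block_family V \<longrightarrow> C \<inter> V \<noteq> {})"

definition block_seq :: "(nat \<Rightarrow> nat set) \<Rightarrow> bool" where
  "block_seq d \<longleftrightarrow> (\<forall>n. finite (d n) \<and> d n \<noteq> {}) \<and> (\<forall>i j. i < j \<longrightarrow> d i \<lless> d j)"

lemma block_familyD:
  assumes "block_family U"
  shows "H \<in> U \<Longrightarrow> finite H" "H \<in> U \<Longrightarrow> H \<noteq> {}"
    and "H \<in> U \<Longrightarrow> K \<in> U \<Longrightarrow> H \<lless> K \<Longrightarrow> H \<union> K \<in> U"
  using assms by (auto simp: block_family_def)

lemma block_family_nonempty: "block_family U \<Longrightarrow> U \<noteq> {}"
  by (auto simp: block_family_def)

lemma block_family_beyond: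
  assumes "block_family U" "finite d"
  shows "block_family (beyond d U)"
  unfolding block_family_def
proof (intro conjI allI ballI impI)
  fix m
  obtain k where k: "\<forall>i\<in>d. i \<le> k"
    using \<open>finite d\<close> finite_nat_set_iff_bounded_le by blast
  obtain H where "H \<in> U" "{..max m k} \<lless> H"
    using assms(1) unfolding block_family_def by blast
  then have "d \<lless> H" "{..m} \<lless> H"
    using k unfolding precedes_def by (meson atMost_iff max.coboundedI1 max.coboundedI2)+
  then show "\<exists>H\<in>beyond d U. {..m} \<lless> H"
    using \<open>H \<in> U\<close> by (auto simp: beyond_def)
qed (use assms(1) in \<open>auto simp: block_family_def beyond_def precedes_def\<close>)

lemma largeE:
  assumes "large C U" "block_family V" "V \<subseteq> U"
  obtains H where "H \<in> V" "H \<in> C"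
  using assms unfolding large_def by blast

lemma large_mono: "large C U \<Longrightarrow> C \<subseteq> D \<Longrightarrow> V \<subseteq> U \<Longrightarrow> large D V"
  unfolding large_def by (metis disjoint_iff order_trans subsetD)

lemma block_seq_ge:
  assumes "block_seq d" "h \<in> d n"
  shows "n \<le> h"
  using assms(2)
proof (induction n arbitrary: h)
  case (Suc n)
  obtain k where k: "k \<in> d n" using assms(1) unfolding block_seq_def by blast
  with Suc.IH have "n \<le> k" by blast
  moreover have "k < h" using assms(1) k Suc.prems lessI unfolding block_seq_def precedes_def by blast
  ultimately show ?case by simp
qed simp

text \<open>A block family is closed only under unions of blocks in order, so the blocks are joined
  by increasing index, the largest one last.\<close>

lemma Union_block_seq_mem:
  assumes U: "block_family U" and d: "block_seq d"
    and "finite I" "I \<noteq> {}" "\<forall>i\<in>I. d i \<in> U"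
  shows "\<Union>(d ` I) \<in> U"
  using assms(3-)
proof (induction I rule: finite_linorder_max_induct)
  case (insert n I)
  show ?case
  proof (cases "I = {}")
    case False
    then have "\<Union>(d ` I) \<in> U" using insert by simp
    moreover have "\<Union>(d ` I) \<lless> d n"
      using d insert.hyps by (fastforce simp: block_seq_def precedes_def)
    ultimately have "\<Union>(d ` I) \<union> d n \<in> U"
      using block_familyD(3)[OF U] insert.prems by simp
    then show ?thesis by (simp add: Un_commute)
  qed (use insert in simp)
qed simp

text \<open>The predicate \<open>Q\<close> restricts the index sets: below it is either
  \<open>2 \<le> card I\<close> or \<open>True\<close>.\<close>

lemma block_family_Unions:
  assumes d: "block_seq d"
    and unbounded: "\<And>m. \<exists>I. finite I \<and> I \<noteq> {} \<and> I \<subseteq> {m..} \<and> Q I"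
    and union: "\<And>I J. finite I \<Longrightarrow> finite J \<Longrightarrow> Q I \<Longrightarrow> Q J \<Longrightarrow> Q (I \<union> J)"
  shows "block_family {\<Union>(d ` I) |I. finite I \<and> I \<noteq> {} \<and> Q I}"
  unfolding block_family_def
proof (intro conjI allI ballI impI)
  fix m
  obtain I where I: "finite I" "I \<noteq> {}" "I \<subseteq> {Suc m..}" "Q I" using unbounded by blast
  have "{..m} \<lless> \<Union>(d ` I)"
    unfolding precedes_def using block_seq_ge[OF d] I(3) by fastforce
  with I show "\<exists>H\<in>{\<Union>(d ` I) |I. finite I \<and> I \<noteq> {} \<and> Q I}. {..m} \<lless> H" by blast
next
  fix H K assume "H \<in> {\<Union>(d ` I) |I. finite I \<and> I \<noteq> {} \<and> Q I}" 
    and "K \<in> {\<Union>(d ` I) |I. finite I \<and> I \<noteq> {} \<and> Q I}"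
  then obtain I J where "H = \<Union>(d ` I)" "finite I" "I \<noteq> {}" "Q I"
    "K = \<Union>(d ` J)" "finite J" "J \<noteq> {}" "Q J" by blast
  then show "H \<union> K \<in> {\<Union>(d ` I) |I. finite I \<and> I \<noteq> {} \<and> Q I}"
    using union by (intro CollectI exI[of _ "I \<union> J"]) auto
qed (use d in \<open>auto simp: block_seq_def\<close>)

text \<open>The diagonal argument used in every later construction: one block is taken from each of
  a shrinking chain of families, and each family lies beyond the block taken before it.\<close>

lemma decreasing_block_families:
  assumes U: "\<And>n. block_family (U n)" and d: "\<And>n. d n \<in> U n"
    and step: "\<And>n. U (Suc n) \<subseteq> beyond (d n) (U n)"
  shows "block_seq d" and "m \<le> n \<Longrightarrow> U n \<subseteq> U m"
proof -
  have mono: "m \<le> n \<Longrightarrow> U n \<subseteq> U m" for m n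
    by (rule lift_Suc_antimono_le[of U]) (use step in \<open>auto simp: beyond_def\<close>)
  then show "m \<le> n \<Longrightarrow> U n \<subseteq> U m" .
  have "d i \<lless> d j" if "i < j" for i j
  proof -
    have "d j \<in> U (Suc i)" using mono[of "Suc i" j] d[of j] that by auto
    then show ?thesis using step by (auto simp: beyond_def)
  qed
  then show "block_seq d"
    unfolding block_seq_def using block_familyD(1,2)[OF U d] by blast
qed

lemma block_seq_exists:
  assumes "block_family V"
  shows "\<exists>d. block_seq d \<and> (\<forall>n. d n \<in> V)"
proof -
  have "\<exists>d. \<forall>n. (d n \<in> V \<and> d n \<noteq> {}) \<and> (\<exists>m. d n \<subseteq> {..m} \<and> {..m} \<lless> d (Suc n))"
  proof (rule dependent_nat_choice)
    show "\<exists>H. H \<in> V \<and> H \<noteq> {}"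
      using assms block_family_nonempty block_familyD(2) by blast
    fix H and n :: nat assume "H \<in> V \<and> H \<noteq> {}"
    then obtain m where "H \<subseteq> {..m}"
      using block_familyD(1)[OF assms] finite_nat_set_iff_bounded_le by (meson atMost_iff subsetI)
    moreover obtain K where "K \<in> V" "{..m} \<lless> K" using assms unfolding block_family_def by blast
    ultimately show "\<exists>K. (K \<in> V \<and> K \<noteq> {}) \<and> (\<exists>m. H \<subseteq> {..m} \<and> {..m} \<lless> K)"
      using block_familyD(2)[OF assms] by blast
  qed
  then obtain d where d: "\<And>n. d n \<in> V" "\<And>n. d n \<noteq> {}" "\<And>n. d n \<lless> d (Suc n)"
    unfolding precedes_def by (metis subsetD)
  have trans: "H \<lless> L" if "H \<lless> K" "K \<lless> L" "K \<noteq> {}" for H K L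
    using that unfolding precedes_def by (metis all_not_in_conv less_trans)
  have "d i \<lless> d j" if "i < j" for i j
    using that by (induction rule: less_Suc_induct) (use d trans in blast)+
  then show ?thesis
    using d(1) block_familyD(1)[OF assms d(1)] d(2) unfolding block_seq_def by (intro exI[of _ d]) simp
qed

section \<open>Baumgartner's proof of Hindman's theorem\<close>

text \<open>Partition regularity, at the price of a smaller family. If \<open>C e\<close> is not
  large, some subfamily misses it entirely, and on that subfamily the remaining sets already have a
  large union.\<close>

lemma large_UN:
  assumes "finite E" "block_family V" "large (\<Union>d\<in>E. C d) V"
  shows "\<exists>d\<in>E. \<exists>W\<subseteq>V. block_family W \<and> large (C d) W"
  using assms
proof (induction E arbitrary: V rule: finite_induct)
  case empty
  then show ?case by (auto simp: large_def)
next
  case (insert e E)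
  show ?case
  proof (cases "large (C e) V")
    case False
    then obtain W where W: "W \<subseteq> V" "block_family W" "C e \<inter> W = {}"
      by (auto simp: large_def)
    have "large (\<Union>d\<in>E. C d) W"
      unfolding large_def
    proof (intro allI impI)
      fix X assume "X \<subseteq> W" "block_family X"
      then have "(\<Union>d\<in>insert e E. C d) \<inter> X \<noteq> {}"
        using insert.prems(2) W(1) unfolding large_def by (meson order_trans)
      then show "(\<Union>d\<in>E. C d) \<inter> X \<noteq> {}" using W(3) \<open>X \<subseteq> W\<close> by auto
    qed
    from insert.IH[OF W(2) this] show ?thesis using W(1) by (meson insertI2 order_trans)
  qed (use insert.prems in blast)
qed

text \<open>Otherwise blocks \<open>d n\<close> can be chosen one after the other so that joining
  \<open>d n\<close> to any union of earlier blocks leaves \<open>C\<close>. The unions of at least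
  two of these blocks then form a block family missing \<open>C\<close>, against largeness.\<close>

lemma large_finite_translates:
  assumes U: "block_family U" and C: "large C U"
  shows "\<exists>E V. finite E \<and> E \<subseteq> U \<and> V \<subseteq> U \<and> block_family V \<and> (\<forall>s\<in>V. \<exists>d\<in>E. d \<union> s \<in> C)"
proof (rule ccontr)
  assume neg: "\<not> ?thesis"
  have "\<exists>s. s \<in> beyond (\<Union>E) U \<and> (\<forall>e\<in>E. e \<union> s \<notin> C)" if "finite E" "E \<subseteq> U" for E
  proof -
    have "finite (\<Union>E)" using that block_familyD(1)[OF U] by auto
    then have "block_family (beyond (\<Union>E) U)" using block_family_beyond[OF U] by simp
    moreover have "beyond (\<Union>E) U \<subseteq> U" by (auto simp: beyond_def)
    ultimately show ?thesis using neg that by metis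
  qed
  then obtain f where f: "\<And>E. finite E \<Longrightarrow> E \<subseteq> U \<Longrightarrow> f E \<in> beyond (\<Union>E) U"
    "\<And>E e. finite E \<Longrightarrow> E \<subseteq> U \<Longrightarrow> e \<in> E \<Longrightarrow> e \<union> f E \<notin> C"
    by metis
  \<comment> \<open>\<open>E n\<close> gathers all nonempty unions of the blocks \<open>d i\<close>
    with \<open>i < n\<close>; the next block \<open>d n\<close> is the one that \<open>f\<close>
    provides against all of them.\<close>
  define E where "E = rec_nat {} (\<lambda>_ E. insert (f E) (E \<union> (\<lambda>e. e \<union> f E) ` E))"
  define d where "d n = f (E n)" for n
  have E_0: "E 0 = {}" and E_Suc: "E (Suc n) = insert (d n) (E n \<union> (\<lambda>e. e \<union> d n) ` E n)" for n
    by (simp_all add: E_def d_def)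
  have E: "finite (E n) \<and> E n \<subseteq> U" for n
  proof (induction n)
    case (Suc n)
    then have "d n \<in> U" "\<forall>e\<in>E n. e \<lless> d n"
      using f(1)[of "E n"] by (auto simp: d_def beyond_def precedes_def)
    then show ?case using Suc block_familyD(3)[OF U] by (auto simp: E_Suc)
  qed (simp add: E_0)
  have E_Union: "\<Union>(d ` I) \<in> E n" if "finite I" "I \<noteq> {}" "I \<subseteq> {..<n}" for I n
    using that
  proof (induction n arbitrary: I)
    case (Suc n)
    show ?case
    proof (cases "n \<in> I")
      case True
      have eq: "\<Union>(d ` I) = \<Union>(d ` (I - {n})) \<union> d n" using True by auto
      show ?thesis
      proof (cases "I - {n} = {}")
        case False
        have "\<Union>(d ` (I - {n})) \<in> E n" using Suc.prems by (intro Suc.IH False) auto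
        then show ?thesis unfolding eq E_Suc by blast
      next
        case empty: True
        show ?thesis unfolding eq empty E_Suc by simp
      qed
    next
      case False
      then have "I \<subseteq> {..<n}" using Suc.prems(3) by (auto simp: less_Suc_eq)
      then show ?thesis using Suc by (simp add: E_Suc)
    qed
  qed simp
  have dU: "d n \<in> U" and d_beyond: "\<Union>(E n) \<lless> d n" for n
    using f(1)[of "E n"] E[of n] by (auto simp: d_def beyond_def)
  have "d i \<lless> d j" if "i < j" for i j
    using E_Union[of "{i}" j] that d_beyond[of j] by (auto simp: precedes_def)
  then have d: "block_seq d"
    using dU block_familyD(1,2)[OF U] by (auto simp: block_seq_def)
  let ?W = "{\<Union>(d ` I) |I. finite I \<and> I \<noteq> {} \<and> 2 \<le> card I}"
  \<comment> \<open>Only unions of at least two blocks avoid \<open>C\<close>; a single \<open>d n\<close> may belong to it.\<close>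
  have "block_family ?W"
  proof (rule block_family_Unions[OF d])
    show "\<exists>I. finite I \<and> I \<noteq> {} \<and> I \<subseteq> {m..} \<and> 2 \<le> card I" for m :: nat
      by (rule exI[of _ "{m, Suc m}"]) auto
    show "2 \<le> card (I \<union> J)" if "finite I" "finite J" "2 \<le> card I" "2 \<le> card J" for I J :: "nat set"
      using that by (meson card_mono finite_UnI le_trans sup_ge1)
  qed
  moreover have "?W \<subseteq> U" using Union_block_seq_mem[OF U d] dU by auto
  ultimately obtain s where "s \<in> ?W" "s \<in> C" by (rule largeE[OF C])
  then obtain I where I: "finite I" "I \<noteq> {}" "2 \<le> card I" "\<Union>(d ` I) \<in> C" by auto
  \<comment> \<open>Split off the last block: the union of the others lies in \<open>E n\<close>, so
    \<open>d n\<close> was chosen to push it out of \<open>C\<close>.\<close>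
  define n where "n = Max I"
  have n: "n \<in> I" "I - {n} \<subseteq> {..<n}"
    using I(1,2) by (auto simp: n_def order.strict_iff_order)
  have "I - {n} \<noteq> {}"
    using I(3) n(1) by (metis card_1_singleton_iff card_Diff_singleton card.empty
        Suc_1 diff_Suc_1 not_less_eq_eq diff_le_mono le_zero_eq zero_neq_one)
  then have "\<Union>(d ` (I - {n})) \<in> E n" using I(1) n by (intro E_Union) auto
  then have "\<Union>(d ` (I - {n})) \<union> d n \<notin> C"
    using f(2)[of "E n"] E[of n] by (simp add: d_def)
  moreover have "\<Union>(d ` (I - {n})) \<union> d n = \<Union>(d ` I)" using n by auto
  ultimately show False using I(4) by simp
qed

text \<open>On \<open>V\<close> every element of \<open>C\<close> lies in one of the finitely many
  sets \<open>{t \<in> C. d \<union> t \<in> C}\<close> with \<open>d \<in> E\<close>, so their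
  union is large and partition regularity singles out one \<open>d\<close>. This \<open>d\<close>
  need not lie in \<open>C\<close>.\<close>

lemma large_translate:
  assumes U: "block_family U" and C: "large C U"
  shows "\<exists>d\<in>U. \<exists>W\<subseteq>beyond d U. block_family W \<and> large {t \<in> C. d \<union> t \<in> C} W"
proof -
  obtain E V where E: "finite E" "E \<subseteq> U" and V: "V \<subseteq> U" "block_family V"
    and EV: "\<And>s. s \<in> V \<Longrightarrow> \<exists>d\<in>E. d \<union> s \<in> C"
    using large_finite_translates[OF U C] by metis
  have "large (\<Union>d\<in>E. {t \<in> C. d \<union> t \<in> C}) V"
    unfolding large_def
  proof (intro allI impI)
    fix W assume W: "W \<subseteq> V" "block_family W"
    then obtain t where "t \<in> W" "t \<in> C" using V(1) by (meson largeE[OF C] order_trans)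
    then show "(\<Union>d\<in>E. {t \<in> C. d \<union> t \<in> C}) \<inter> W \<noteq> {}" using EV W(1) by blast
  qed
  from large_UN[OF E(1) V(2) this] obtain d W
    where d: "d \<in> E" "W \<subseteq> V" "block_family W" "large {t \<in> C. d \<union> t \<in> C} W" by blast
  have "finite d" using d(1) E(2) block_familyD(1)[OF U] by blast
  then have "block_family (beyond d W)" using d(3) by (rule block_family_beyond[rotated])
  moreover have "large {t \<in> C. d \<union> t \<in> C} (beyond d W)"
    using d(4) by (rule large_mono) (auto simp: beyond_def)
  moreover have "beyond d W \<subseteq> beyond d U" using d(2) V(1) by (auto simp: beyond_def)
  ultimately show ?thesis using d(1) E(2) by blast
qed

text \<open>Iterates a translation step with
  \<open>D (Suc n) = {t \<in> D n. d n \<union> t \<in> D n}\<close>. The parameter \<open>T\<close>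
  lets the same construction run first with no condition on \<open>d\<close>, and then with
  \<open>d \<in> C\<close>.\<close>

lemma large_iterate:
  assumes step: "\<And>C U. block_family U \<Longrightarrow> large C U \<Longrightarrow>
      \<exists>d\<in>U. T C d \<and> (\<exists>W\<subseteq>beyond d U. block_family W \<and> large {t \<in> C. d \<union> t \<in> C} W)"
    and U: "block_family U" and C: "large C U"
  obtains d V D where "block_seq d" "V 0 = U" "D 0 = C"
    "\<And>n. block_family (V n)" "\<And>n. large (D n) (V n)"
    "\<And>n. d n \<in> V n" "\<And>n. V (Suc n) \<subseteq> beyond (d n) (V n)" "\<And>n. T (D n) (d n)"
    "\<And>I n t. I \<subseteq> {..<n} \<Longrightarrow> t \<in> D n \<Longrightarrow> \<Union>(d ` I) \<union> t \<in> C"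
    "\<And>n. D n \<subseteq> C"
proof -
  \<comment> \<open>Dependent choice does not fix the initial pair, so the invariant itself records
    that it is \<open>(U, C)\<close>.\<close>
  let ?P = "\<lambda>n (V, D). block_family V \<and> large D V \<and> (n = 0 \<longrightarrow> V = U \<and> D = C)"
  let ?R = "\<lambda>(V, D) (V', D') d. d \<in> V \<and> T D d \<and> V' \<subseteq> beyond d V \<and> D' = {t \<in> D. d \<union> t \<in> D}"
  have "\<exists>S. \<forall>n. ?P n (S n) \<and> (\<exists>d. ?R (S n) (S (Suc n)) d)"
  proof (rule dependent_nat_choice)
    show "\<exists>S. ?P 0 S" using U C by auto
    fix S and n :: nat assume "?P n S"
    then show "\<exists>S'. ?P (Suc n) S' \<and> (\<exists>d. ?R S S' d)"
      using step[of "fst S" "snd S"] by (auto split: prod.splits)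
  qed
  then obtain S where S: "\<forall>n. ?P n (S n) \<and> (\<exists>d. ?R (S n) (S (Suc n)) d)" ..
  then have "\<forall>n. \<exists>d. ?R (S n) (S (Suc n)) d" by (rule all_forward) (rule conjunct2)
  from choice[OF this] obtain d where d: "\<forall>n. ?R (S n) (S (Suc n)) (d n)" ..
  define V D where "V n = fst (S n)" and "D n = snd (S n)" for n
  have V: "block_family (V n)" "large (D n) (V n)" "d n \<in> V n" "V (Suc n) \<subseteq> beyond (d n) (V n)"
      "T (D n) (d n)" and D_Suc: "D (Suc n) = {t \<in> D n. d n \<union> t \<in> D n}" for n
    using spec[OF S, of n] spec[OF d, of n] by (auto simp: V_def D_def split: prod.splits)
  have 0: "V 0 = U" "D 0 = C" using spec[OF S, of 0] by (auto simp: V_def D_def split: prod.splits)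
  have un: "\<Union>(d ` I) \<union> t \<in> C" if "I \<subseteq> {..<n}" "t \<in> D n" for I n t
    using that
  proof (induction n arbitrary: I t)
    case 0
    then show ?case by (simp add: \<open>D 0 = C\<close>)
  next
    case (Suc n)
    have sub: "I - {n} \<subseteq> {..<n}" using Suc.prems(1) by (auto simp: less_Suc_eq)
    show ?case
    proof (cases "n \<in> I")
      case True
      \<comment> \<open>The block \<open>d n\<close> is absorbed into \<open>t\<close>: from
        \<open>t \<in> D (Suc n)\<close> follows \<open>d n \<union> t \<in> D n\<close>.\<close>
      have "\<Union>(d ` (I - {n})) \<union> (d n \<union> t) \<in> C"
        using Suc.IH[OF sub] Suc.prems(2) by (simp add: D_Suc)
      moreover have "\<Union>(d ` (I - {n})) \<union> (d n \<union> t) = \<Union>(d ` I) \<union> t" using True by auto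
      ultimately show ?thesis by simp
    next
      case False
      then show ?thesis using Suc.IH[OF sub] Suc.prems(2) by (simp add: D_Suc)
    qed
  qed
  have "D n \<subseteq> C" for n using un[of "{}" n] by auto
  with that[of d V D] decreasing_block_families(1)[of V d] V 0 un show thesis by blast
qed

lemma Max_decompose:
  fixes I :: "nat set"
  assumes "finite I" "I \<noteq> {}"
  obtains J n where "I = insert n J" "J \<subseteq> {..<n}" "n \<notin> J" "finite J"
proof (rule that[of "Max I" "I - {Max I}"])
  show "I - {Max I} \<subseteq> {..<Max I}" using assms by (auto simp: order.strict_iff_order)
qed (use assms Max_in in auto)

text \<open>Improves \<open>large_translate\<close> by placing the translating block in
  \<open>C\<close>. The iterated blocks generate a block family, so \<open>C\<close> contains one of
  their unions \<open>s\<close>; joining \<open>s\<close> to any member of a late enough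
  \<open>D n\<close> stays in \<open>C\<close>, and that \<open>D n\<close> is large.\<close>

lemma large_translate_mem:
  assumes U: "block_family U" and C: "large C U"
  shows "\<exists>s\<in>U. s \<in> C \<and> (\<exists>W\<subseteq>beyond s U. block_family W \<and> large {t \<in> C. s \<union> t \<in> C} W)"
proof -
  have step: "\<exists>d\<in>U. True \<and> (\<exists>W\<subseteq>beyond d U. block_family W \<and> large {t \<in> C. d \<union> t \<in> C} W)"
    if "block_family U" "large C U" for C U
    using large_translate[OF that] by blast
  obtain d V D where d: "block_seq d" and V0: "V 0 = U" and "D 0 = C"
    and V: "\<And>n. block_family (V n)" "\<And>n. large (D n) (V n)"
      "\<And>n. d n \<in> V n" "\<And>n. V (Suc n) \<subseteq> beyond (d n) (V n)"
    \<comment> \<open>The clause for \<open>T\<close>, here constantly true.\<close>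
    and "\<And>n. True"
    and D: "\<And>I n t. I \<subseteq> {..<n} \<Longrightarrow> t \<in> D n \<Longrightarrow> \<Union>(d ` I) \<union> t \<in> C" "\<And>n. D n \<subseteq> C"
    by (rule large_iterate[where T = "\<lambda>_ _. True", OF _ U C])
      (erule (1) step, (rule that; assumption))
  have mono: "V n \<subseteq> V m" if "m \<le> n" for m n
    using decreasing_block_families(2)[of V d, OF V(1,3,4) that] .
  let ?W = "{\<Union>(d ` I) |I. finite I \<and> I \<noteq> {} \<and> True}"
  have W: "block_family ?W"
    by (rule block_family_Unions[OF d]) (auto intro: exI[of _ "{m}" for m])
  have WU: "?W \<subseteq> U" using Union_block_seq_mem[OF U d] V(3) mono[of 0] V0 by blast
  obtain s where "s \<in> ?W" "s \<in> C" using W WU by (rule largeE[OF C])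
  then obtain I where I: "finite I" "I \<noteq> {}" "\<Union>(d ` I) \<in> C" by auto
  \<comment> \<open>One past the last index, so that \<open>V n\<close> lies beyond every block
    making up \<open>s\<close>.\<close>
  define n where "n = Suc (Max I)"
  have In: "I \<subseteq> {..<n}" using I(1) by (auto simp: n_def less_Suc_eq_le)
  have "V n \<subseteq> beyond (\<Union>(d ` I)) U"
  proof
    fix H assume H: "H \<in> V n"
    have "d i \<lless> H" if "i \<in> I" for i
    proof -
      have "Suc i \<le> n" using that In by auto
      then show ?thesis using mono[of "Suc i" n] V(4)[of i] H by (auto simp: beyond_def)
    qed
    then show "H \<in> beyond (\<Union>(d ` I)) U"
      using H mono[of 0 n] V0 by (auto simp: beyond_def precedes_def)
  qed
  moreover have "large {t \<in> C. \<Union>(d ` I) \<union> t \<in> C} (V n)"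
    using V(2)[of n] by (rule large_mono) (use D(1)[OF In] subsetD[OF D(2)] in auto)
  ultimately show ?thesis using V(1) WU I by blast
qed

text \<open>With \<open>T\<close> as membership, each \<open>d n\<close> lies in \<open>D n\<close>.
  A union with largest index \<open>n\<close> is then a union of earlier blocks joined to a member
  of \<open>D n\<close>, hence lies in \<open>C\<close>.\<close>

theorem hindman_large:
  assumes U: "block_family U" and C: "large C U"
  shows "\<exists>W\<subseteq>U. block_family W \<and> W \<subseteq> C"
proof -
  obtain d V D where d: "block_seq d" and V0: "V 0 = U" and "D 0 = C"
    and V: "\<And>n. block_family (V n)" "\<And>n. large (D n) (V n)"
      "\<And>n. d n \<in> V n" "\<And>n. V (Suc n) \<subseteq> beyond (d n) (V n)"
    and dD: "\<And>n. d n \<in> D n"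
    and D: "\<And>I n t. I \<subseteq> {..<n} \<Longrightarrow> t \<in> D n \<Longrightarrow> \<Union>(d ` I) \<union> t \<in> C" "\<And>n. D n \<subseteq> C"
    by (rule large_iterate[where T = "\<lambda>C d. d \<in> C", OF _ U C])
      (erule (1) large_translate_mem, (rule that; assumption))
  let ?W = "{\<Union>(d ` I) |I. finite I \<and> I \<noteq> {} \<and> True}"
  have "block_family ?W"
    by (rule block_family_Unions[OF d]) (auto intro: exI[of _ "{m}" for m])
  moreover have "?W \<subseteq> U"
    using Union_block_seq_mem[OF U d] decreasing_block_families(2)[of V d 0, OF V(1,3,4)] V(3) V0 by blast
  moreover have "?W \<subseteq> C"
  proof clarify
    fix I :: "nat set" assume "finite I" "I \<noteq> {}"
    then obtain n J where "I = insert n J" "J \<subseteq> {..<n}" by (rule Max_decompose)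
    then show "\<Union>(d ` I) \<in> C" using D(1)[OF _ dD] by (simp add: Un_commute)
  qed
  ultimately show ?thesis by blast
qed

section \<open>Sums and products in an \<open>IP\<^sup>*\<close> set\<close>

lemma sum_Union_block_seq:
  assumes "block_seq d" "finite I"
  shows "sum x (\<Union>(d ` I)) = (\<Sum>i\<in>I. sum x (d i))"
proof (rule sum.UNION_disjoint[OF assms(2)])
  show "\<forall>i\<in>I. finite (d i)" using assms(1) by (simp add: block_seq_def)
  show "\<forall>i\<in>I. \<forall>j\<in>I. i \<noteq> j \<longrightarrow> d i \<inter> d j = {}"
    using assms(1) unfolding block_seq_def precedes_def
    by (metis disjoint_iff less_irrefl nat_neq_iff)
qed

lemma sum_block_pos:
  assumes "pos_seq x" "finite H" "H \<noteq> {}"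
  shows "0 < sum x H"
  using assms by (intro sum_pos) (auto simp: pos_seq_def Suc_le_eq)

text \<open>The point where the \<open>IP\<^sup>*\<close> property enters. A block sequence in
  \<open>V\<close> yields the sequence \<open>p * sum x (d n)\<close>, whose finite sums are
  \<open>p\<close> times the sums of \<open>x\<close> over unions of blocks, and \<open>A\<close>
  meets these finite sums.\<close>

lemma large_dilate:
  assumes x: "pos_seq x" and A: "IP_star_set A" and p: "0 < p"
  shows "large {H. p * sum x H \<in> A} U"
  unfolding large_def
proof (intro allI impI)
  fix V assume V: "block_family V"
  obtain d where d: "block_seq d" "\<And>n. d n \<in> V" using block_seq_exists[OF V] by blast
  define z where "z n = p * sum x (d n)" for n
  have z: "pos_seq z"
    using d(1) sum_block_pos[OF x] p by (auto simp: pos_seq_def z_def block_seq_def Suc_le_eq)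
  have "FS z \<subseteq> {1..}"
  proof
    fix s assume "s \<in> FS z"
    then obtain H where "s = sum z H" "finite H" "H \<noteq> {}" by (auto simp: FS_def)
    then show "s \<in> {1..}" using sum_block_pos[OF z, of H] by (metis One_nat_def Suc_leI atLeast_iff)
  qed
  then have "IP_set (FS z)" using z by (auto simp: IP_set_def)
  then have "A \<inter> FS z \<noteq> {}" using A by (simp add: IP_star_set_def)
  then obtain s where "s \<in> FS z" "s \<in> A" by blast
  then obtain I where I: "finite I" "I \<noteq> {}" "sum z I \<in> A" by (auto simp: FS_def)
  have "sum z I = p * sum x (\<Union>(d ` I))"
    by (simp add: z_def sum_Union_block_seq[OF d(1) I(1)] sum_distrib_left)
  moreover have "\<Union>(d ` I) \<in> V" using Union_block_seq_mem[OF V d(1)] I d(2) by blast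
  ultimately show "{H. p * sum x H \<in> A} \<inter> V \<noteq> {}" using I(3) by auto
qed

text \<open>One application of Hindman's theorem for each \<open>p\<close>; conditions already
  secured survive in subfamilies. The factor \<open>0\<close> must be excluded because
  \<open>A\<close> contains only positive integers.\<close>

lemma block_family_dilates:
  assumes x: "pos_seq x" and A: "IP_star_set A"
    and "finite P" "0 \<notin> P" "block_family U"
  shows "\<exists>W\<subseteq>U. block_family W \<and> (\<forall>H\<in>W. \<forall>p\<in>P. p * sum x H \<in> A)"
  using assms(3-)
proof (induction P rule: finite_induct)
  case (insert p P)
  then obtain W where W: "W \<subseteq> U" "block_family W" "\<forall>H\<in>W. \<forall>p\<in>P. p * sum x H \<in> A" by auto
  have "large {H. p * sum x H \<in> A} W" using insert.prems(1) by (intro large_dilate x A) auto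
  from hindman_large[OF W(2) this] obtain W'
    where "W' \<subseteq> W" "block_family W'" "W' \<subseteq> {H. p * sum x H \<in> A}" by blast
  with W show ?case by (intro exI[of _ W']) auto
qed auto

lemma block_family_all: "block_family {H. finite H \<and> H \<noteq> {}}"
  unfolding block_family_def
proof (intro conjI allI)
  fix m show "\<exists>H\<in>{H. finite H \<and> H \<noteq> {}}. {..m} \<lless> H"
    by (rule bexI[of _ "{Suc m}"]) (auto simp: precedes_def)
qed auto

theorem theorem1:
  fixes x :: "nat \<Rightarrow> nat" and A :: "nat set"
  assumes "pos_seq x"
    and "IP_star_set A"
  shows "\<exists>y. sum_subsystem y x \<and> FS y \<union> FP y \<subseteq> A"
proof -
  \<comment> \<open>\<open>P\<close> holds the products of distinct terms chosen so far, with
    \<open>1\<close> as the empty product. Every block still available keeps its sum in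
    \<open>A\<close> after multiplication by any of them.\<close>
  let ?Q = "\<lambda>n (U, P). block_family U \<and> finite P \<and> 0 \<notin> P \<and> 1 \<in> P \<and>
    (\<forall>H\<in>U. \<forall>p\<in>P. p * sum x H \<in> A)"
  let ?R = "\<lambda>(U, P) (U', P') d. d \<in> U \<and> U' \<subseteq> beyond d U \<and> P' = P \<union> (\<lambda>p. p * sum x d) ` P"
  have "\<exists>S. \<forall>n. ?Q n (S n) \<and> (\<exists>d. ?R (S n) (S (Suc n)) d)"
  proof (rule dependent_nat_choice)
    have "\<exists>W\<subseteq>{H. finite H \<and> H \<noteq> {}}. block_family W \<and> (\<forall>H\<in>W. \<forall>p\<in>{1}. p * sum x H \<in> A)"
      by (rule block_family_dilates[OF assms _ _ block_family_all]) auto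
    then obtain W where "block_family W" "\<forall>H\<in>W. \<forall>p\<in>{1}. p * sum x H \<in> A" by blast
    then show "\<exists>S. ?Q 0 S" by (intro exI[of _ "(W, {1})"]) auto
    fix S and n :: nat assume Q: "?Q n S"
    obtain U P where S: "S = (U, P)" by fastforce
    have U: "block_family U" and P: "finite P" "0 \<notin> P" "1 \<in> P" using Q S by auto
    obtain d where d: "d \<in> U" using block_family_nonempty[OF U] by blast
    \<comment> \<open>The old products, and the old products times the new term.\<close>
    let ?P = "P \<union> (\<lambda>p. p * sum x d) ` P"
    have fin: "finite d" "d \<noteq> {}" using d block_familyD[OF U] by auto
    have "0 \<notin> ?P" using P sum_block_pos[OF assms(1) fin] by (auto simp del: sum_eq_0_iff)
    then obtain W where "W \<subseteq> beyond d U" "block_family W" "\<forall>H\<in>W. \<forall>p\<in>?P. p * sum x H \<in> A"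
      using block_family_dilates[OF assms, of ?P "beyond d U"] P block_family_beyond[OF U fin(1)]
      by blast
    then show "\<exists>S'. ?Q (Suc n) S' \<and> (\<exists>d. ?R S S' d)"
      using d P \<open>0 \<notin> ?P\<close> by (intro exI[of _ "(W, ?P)"]) (auto simp: S)
  qed
  then obtain S where S: "\<forall>n. ?Q n (S n) \<and> (\<exists>d. ?R (S n) (S (Suc n)) d)" ..
  then have "\<forall>n. \<exists>d. ?R (S n) (S (Suc n)) d" by (rule all_forward) (rule conjunct2)
  from choice[OF this] obtain d where R: "\<forall>n. ?R (S n) (S (Suc n)) (d n)" ..
  define U P where "U n = fst (S n)" and "P n = snd (S n)" for n
  have U: "block_family (U n)" "d n \<in> U n" "U (Suc n) \<subseteq> beyond (d n) (U n)"
    and P: "P (Suc n) = P n \<union> (\<lambda>p. p * sum x (d n)) ` P n" "1 \<in> P n"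
    and UP: "H \<in> U n \<Longrightarrow> p \<in> P n \<Longrightarrow> p * sum x H \<in> A" for n H p
    using spec[OF S, of n] spec[OF R, of n] by (auto simp: U_def P_def split: prod.splits)
  have d: "block_seq d" and mono: "\<And>m n. m \<le> n \<Longrightarrow> U n \<subseteq> U m"
    using decreasing_block_families[of U d, OF U] by blast+
  define y where "y n = sum x (d n)" for n
  have prod_mem: "prod y I \<in> P n" if "I \<subseteq> {..<n}" for I n
    using that
  proof (induction n arbitrary: I)
    case (Suc n)
    have IH: "prod y (I - {n}) \<in> P n" using Suc.prems by (intro Suc.IH) (auto simp: less_Suc_eq)
    have "finite I" using Suc.prems finite_subset by blast
    with IH show ?case
      by (cases "n \<in> I") (auto simp: P(1) prod.remove[of I n] y_def[of n] mult.commute)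
  qed (use P in simp)
  have "sum_subsystem y x"
    unfolding sum_subsystem_def
  proof (intro exI[of _ d] conjI allI)
    show "finite (d n)" "d n \<noteq> {}" for n using d by (auto simp: block_seq_def)
    then have "Max (d n) \<in> d n" "Min (d (Suc n)) \<in> d (Suc n)" for n by auto
    then show "Max (d n) < Min (d (Suc n))" for n
      using d unfolding block_seq_def precedes_def by blast
  qed (simp add: y_def)
  moreover have "sum y I \<in> A" if "finite I" "I \<noteq> {}" for I
  proof -
    \<comment> \<open>Sums need only the first family and the factor \<open>1\<close>: a sum of
      terms is the sum of \<open>x\<close> over a union of blocks in \<open>U 0\<close>.\<close>
    have "\<forall>i\<in>I. d i \<in> U 0" using U(2) mono[of 0] by auto
    with that have "\<Union>(d ` I) \<in> U 0" by (rule Union_block_seq_mem[OF U(1) d])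
    from UP[OF this P(2)] show ?thesis
      by (simp add: sum_Union_block_seq[OF d that(1)] y_def)
  qed
  moreover have "prod y I \<in> A" if "finite I" "I \<noteq> {}" for I
  proof -
    \<comment> \<open>For products the term of largest index is split off: the earlier terms
      multiply to some \<open>p \<in> P n\<close>, and \<open>d n \<in> U n\<close> gives
      \<open>p * y n \<in> A\<close>.\<close>
    obtain n J where I: "I = insert n J" "J \<subseteq> {..<n}" "n \<notin> J" "finite J"
      using \<open>finite I\<close> \<open>I \<noteq> {}\<close> by (rule Max_decompose)
    show ?thesis using UP[OF U(2) prod_mem[OF I(2)]] I by (simp add: y_def[of n] mult.commute)
  qed
  ultimately show ?thesis by (auto simp: FS_def FP_def)
qed

end
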